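(* For each integer $m\ge 2$ there exists a constant $C_m>1$ such that if $1<\beta_1<\dots<\beta_m<C_m$, then the attractor $A_{\beta_1,\dots,\beta_m}\subset\mathbb R^m$ contains a neighbourhood of $(0,\dots,0)$.
   Context: For $\beta_1,\dots,\beta_m>1$ and $i\in\{-1,1\}$ let $T_i:\mathbb R^m\to\mathbb R^m$, $T_i(x_1,\dots,x_m)=\left(\frac{x_1+i}{\beta_1},\dots,\frac{x_m+i}{\beta_m}\right)$. The attractor $A_{\beta_1,\dots,\beta_m}$ is the unique non-empty compact set $A\subset\mathbb R^m$ with $A=T_1(A)\cup T_{-1}(A)$. *)

theory Defs
  imports "HOL-Analysis.Analysis"
begin

text \<open>
  Points of m-dimensional Euclidean space are vectors whose index type has m elements; the linear
  order on the index type is only there to make sense of an increasing tuple of parameters.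
\<close>

definition ifs_map :: "('m::finite \<Rightarrow> real) \<Rightarrow> real \<Rightarrow> real ^ 'm \<Rightarrow> real ^ 'm" where
  "ifs_map \<beta> i x = (\<chi> j. (x $ j + i) / \<beta> j)"

text \<open>
  The definite description is well defined when all \<open>\<beta> j > 1\<close>, since both maps are then
  contractions; no claim is made about other parameters.
\<close>

definition attractor :: "('m::finite \<Rightarrow> real) \<Rightarrow> (real ^ 'm) set" where
  "attractor \<beta> =
     (THE A. A \<noteq> {} \<and> compact A \<and> A = ifs_map \<beta> 1 ` A \<union> ifs_map \<beta> (-1) ` A)"

end

theory Submission
  imports Defs "HOL-Computational_Algebra.Polynomial"
begin

text \<open>
  The attractor is the set of all vectors with components \<open>\<Sum>n. a n / \<beta> j ^ (n + 1)\<close>, where one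
  sequence \<open>a\<close> of signs serves all coordinates at once (\<open>attractor_eq_address_image\<close>). So every
  small vector \<open>v\<close> must be expanded simultaneously in all the bases \<open>\<beta> j\<close>. In terms of the
  generating function \<open>A\<close> of \<open>a\<close>, this says \<open>A (1 / \<beta> j) = \<beta> j * v $ j\<close> for all \<open>j\<close>.

  Such an \<open>A\<close> is sought in the form \<open>A = E + U * (1 - R)\<close>. Here \<open>E\<close> is a polynomial that takes the
  prescribed values, \<open>R\<close> is a polynomial with \<open>R 0 = 0\<close> and \<open>R (1 / \<beta> j) = 1\<close> for all \<open>j\<close>, and
  \<open>U\<close> is a power series with bounded coefficients, so that the second summand vanishes at all
  points \<open>1 / \<beta> j\<close>. Comparing coefficients, \<open>a\<close> determines \<open>U\<close> recursively, and the signs can be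
  chosen greedily so that the coefficients of \<open>U\<close> stay in \<open>[-1, 1]\<close>, provided that the coefficients
  of \<open>R\<close> and \<open>E\<close> have absolute sum at most 2 (\<open>exists_sign_expansion\<close>). By Lagrange interpolation
  the coefficients of \<open>E\<close> are as small as desired when \<open>v\<close> is small, so everything rests on finding
  \<open>R\<close> with absolute coefficient sum well below 2. Distinctness of the \<open>\<beta> j\<close> enters only through
  interpolation; their closeness to 1 enters only through \<open>R\<close>.

  For the latter, let \<open>r\<^sub>j\<close> be the average of \<open>(\<beta> j * z) ^ n\<close> over \<open>n = 1, \<dots>, K\<close>, which is 1
  at \<open>1 / \<beta> j\<close>, and put \<open>1 - R = (1 - \<beta> i * z) * (\<Prod>j\<noteq>i. 1 - r\<^sub>j)\<close> for one fixed index \<open>i\<close>.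
  Naively the coefficients of such a product could add up to about \<open>2 ^ m\<close>. But \<open>(1 - z) * r\<^sub>j\<close>
  telescopes almost completely when \<open>\<beta> j\<close> is close to 1, so \<open>(1 - \<beta> i * z) * r\<^sub>j\<close> has tiny
  coefficient sum for large \<open>K\<close>. Expanding the product, all terms except \<open>1 - \<beta> i * z\<close> are
  negligible, and the absolute coefficient sum of \<open>R\<close> is close to \<open>\<beta> i\<close>
  (\<open>exists_small_poly_one_at_inverses\<close>).
\<close>

section \<open>The sum of the absolute values of the coefficients of a polynomial\<close>

definition l1_norm :: "real poly \<Rightarrow> real" where
  "l1_norm p = (\<Sum>i\<le>degree p. \<bar>coeff p i\<bar>)"

lemma l1_norm_0 [simp]: "l1_norm 0 = 0"
  by (simp add: l1_norm_def)

lemma l1_norm_pCons [simp]: "l1_norm (pCons a p) = \<bar>a\<bar> + l1_norm p"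
proof (cases "p = 0")
  case True
  then show ?thesis by (simp add: l1_norm_def)
next
  case False
  then show ?thesis
    by (simp add: l1_norm_def sum.atMost_Suc_shift del: sum.atMost_Suc)
qed

lemma l1_norm_nonneg: "0 \<le> l1_norm p"
  by (simp add: l1_norm_def sum_nonneg)

lemma l1_norm_add: "l1_norm (p + q) \<le> l1_norm p + l1_norm q"
proof (induction p q rule: poly_induct2)
  case 0
  then show ?case by simp
next
  case (pCons a p b q)
  then show ?case using abs_triangle_ineq[of a b] by simp
qed

lemma l1_norm_smult [simp]: "l1_norm (smult c p) = \<bar>c\<bar> * l1_norm p"
  by (induction p) (simp_all add: abs_mult distrib_left)

lemma l1_norm_minus [simp]: "l1_norm (- p) = l1_norm p"
  using l1_norm_smult[of "-1" p] by simp

lemma l1_norm_diff: "l1_norm (p - q) \<le> l1_norm p + l1_norm q"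
  using l1_norm_add[of p "- q"] by simp

lemma l1_norm_mult: "l1_norm (p * q) \<le> l1_norm p * l1_norm q"
proof (induction p)
  case 0
  then show ?case by simp
next
  case (pCons a p)
  have "l1_norm (pCons a p * q) \<le> l1_norm (smult a q) + l1_norm (pCons 0 (p * q))"
    unfolding mult_pCons_left by (rule l1_norm_add)
  with pCons show ?case by (simp add: distrib_right)
qed

lemma l1_norm_monom [simp]: "l1_norm (monom c n) = \<bar>c\<bar>"
  by (induction n) (simp_all add: monom_0 monom_Suc)

lemma l1_norm_sum: "l1_norm (sum f S) \<le> (\<Sum>i\<in>S. l1_norm (f i))"
proof (induction S rule: infinite_finite_induct)
  case (insert x F)
  then show ?case using l1_norm_add[of "f x" "sum f F"] by simp
qed simp_all

lemma l1_norm_prod_le: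
  assumes "\<And>j. j \<in> S \<Longrightarrow> l1_norm (p j) \<le> B"
  shows "l1_norm (\<Prod>j\<in>S. p j) \<le> B ^ card S"
  using assms
proof (induction S rule: infinite_finite_induct)
  case (insert x F)
  have "l1_norm (p x * prod p F) \<le> l1_norm (p x) * l1_norm (prod p F)"
    by (rule l1_norm_mult)
  also have "\<dots> \<le> B * B ^ card F"
    using insert order_trans[OF l1_norm_nonneg] by (intro mult_mono) (auto simp: l1_norm_nonneg)
  finally show ?case using insert by simp
qed (simp_all add: one_pCons)

text \<open>
  The range of summation is independent of the degree, so that the bound applies directly to the
  coefficients of a product with a power series.
\<close>

lemma sum_coeff_le_l1_norm: "(\<Sum>i\<le>k. \<bar>coeff p i\<bar>) \<le> l1_norm p"
proof (induction p arbitrary: k)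
  case 0
  then show ?case by simp
next
  case (pCons a p)
  show ?case
  proof (cases k)
    case 0
    then show ?thesis by (simp add: l1_norm_nonneg)
  next
    case (Suc n)
    then show ?thesis using pCons(2)[of n]
      by (simp add: sum.atMost_Suc_shift del: sum.atMost_Suc)
  qed
qed

lemma coeff_le_l1_norm: "\<bar>coeff p k\<bar> \<le> l1_norm p"
proof -
  have "\<bar>coeff p k\<bar> \<le> (\<Sum>i\<le>k. \<bar>coeff p i\<bar>)"
    by (rule member_le_sum) auto
  then show ?thesis using sum_coeff_le_l1_norm[of p k] by linarith
qed

section \<open>Greedy choice of signs\<close>

context
  fixes R E :: "real poly"
begin

text \<open>
  These are the coefficients \<open>u\<close> of the power series \<open>U\<close> with \<open>A = E + U * (1 - R)\<close>: comparing
  coefficients gives \<open>u k = (\<Sum>i<k. coeff R (k - i) * u i) - coeff E k + a k\<close>, and the sign \<open>a k\<close>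
  is taken opposite to the rest of the right-hand side. The recursion is stated without reference to
  \<open>a\<close>, which is read off from \<open>u\<close> afterwards.
\<close>

fun residual :: "nat \<Rightarrow> real" where
  "residual k =
    (let w = (\<Sum>i\<in>{..<k}. coeff R (k - i) * residual i) - coeff E k
     in w + (if w > 0 then -1 else 1))"

declare residual.simps [simp del]

definition drift :: "nat \<Rightarrow> real" where
  "drift k = (\<Sum>i<k. coeff R (k - i) * residual i) - coeff E k"

definition digit :: "nat \<Rightarrow> real" where
  "digit k = (if drift k > 0 then -1 else 1)"

lemma residual_eq: "residual k = drift k + digit k"
  by (subst residual.simps) (simp add: drift_def digit_def Let_def)

text \<open>
  Adding the opposite sign to a number in \<open>[-2, 2]\<close> leads to \<open>[-1, 1]\<close>, and as long as all earlier
  residuals are in \<open>[-1, 1]\<close>, the drift is at most \<open>l1_norm R + l1_norm E\<close>.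
\<close>

lemma abs_residual_le:
  assumes "l1_norm R + l1_norm E \<le> 2"
  shows "\<bar>residual k\<bar> \<le> 1"
proof (induction k rule: less_induct)
  case (less k)
  have "\<bar>\<Sum>i<k. coeff R (k - i) * residual i\<bar> \<le> (\<Sum>i<k. \<bar>coeff R (k - i)\<bar> * 1)"
    using less by (intro order_trans[OF sum_abs] sum_mono) (auto simp: abs_mult intro!: mult_left_le)
  also have "\<dots> = (\<Sum>i\<in>{1..k}. \<bar>coeff R i\<bar>)"
    by (rule sum.reindex_bij_witness[of _ "\<lambda>i. k - i" "\<lambda>i. k - i"]) auto
  also have "\<dots> \<le> (\<Sum>i\<le>k. \<bar>coeff R i\<bar>)"
    by (rule sum_mono2) auto
  also have "\<dots> \<le> l1_norm R"
    by (rule sum_coeff_le_l1_norm)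
  finally have "\<bar>drift k\<bar> \<le> 2"
    using assms coeff_le_l1_norm[of E k] unfolding drift_def by linarith
  then show ?case unfolding residual_eq digit_def by (auto split: if_splits)
qed

end

lemma poly_sums: "(\<lambda>n. coeff p n * x ^ n) sums poly p (x :: real)"
  unfolding poly_altdef by (rule sums_finite) (auto simp: coeff_eq_0)

lemma summable_norm_poly: "summable (\<lambda>n. norm (coeff p n * (x :: real) ^ n))"
  by (rule summable_finite[of "{..degree p}"]) (auto simp: coeff_eq_0)

text \<open>
  The sign sequence depends only on \<open>R\<close> and \<open>E\<close>, so one sequence serves all points at which \<open>R\<close>
  takes the value 1. Inside the unit disc the generating function of the bounded residuals
  converges, and its product with \<open>1 - R\<close> vanishes at those points.
\<close>

lemma exists_sign_expansion:
  assumes "coeff R 0 = 0" and "l1_norm R + l1_norm E \<le> 2"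
  shows "\<exists>a. (\<forall>n. a n \<in> {-1, 1::real}) \<and>
    (\<forall>x. \<bar>x\<bar> < 1 \<longrightarrow> poly R x = 1 \<longrightarrow> (\<lambda>n. a n * x ^ n) sums poly E x)"
proof (intro exI conjI allI impI)
  show "digit R E n \<in> {-1, 1}" for n
    by (simp add: digit_def)
next
  fix x :: real
  assume x: "\<bar>x\<bar> < 1" and R1: "poly R x = 1"
  let ?u = "residual R E"
  have u: "summable (\<lambda>n. norm (?u n * x ^ n))"
  proof (rule summable_comparison_test')
    show "summable (\<lambda>n. \<bar>x\<bar> ^ n)"
      using x by (simp add: summable_geometric)
    show "norm (norm (?u n * x ^ n)) \<le> \<bar>x\<bar> ^ n" for n
      using abs_residual_le[OF assms(2), of n]
      by (simp add: abs_mult power_abs mult_left_le_one_le)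
  qed
  have "(\<lambda>k. \<Sum>i\<le>k. (coeff R i * x ^ i) * (?u (k - i) * x ^ (k - i))) sums
      ((\<Sum>k. coeff R k * x ^ k) * (\<Sum>k. ?u k * x ^ k))"
    by (rule Cauchy_product_sums[OF summable_norm_poly u])
  moreover have "(\<Sum>k. coeff R k * x ^ k) = 1"
    using poly_sums[of R x] R1 by (simp add: sums_iff)
  moreover have "(\<Sum>i\<le>k. (coeff R i * x ^ i) * (?u (k - i) * x ^ (k - i)))
      = (\<Sum>i<k. coeff R (k - i) * ?u i) * x ^ k" for k
  proof -
    have "(\<Sum>i\<le>k. (coeff R i * x ^ i) * (?u (k - i) * x ^ (k - i)))
        = (\<Sum>i\<le>k. coeff R (k - i) * ?u i * x ^ k)"
      by (rule sum.reindex_bij_witness[of _ "\<lambda>i. k - i" "\<lambda>i. k - i"])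
         (auto simp flip: power_add)
    also have "\<dots> = (\<Sum>i<k. coeff R (k - i) * ?u i * x ^ k)"
      by (rule sum.mono_neutral_right) (auto simp: assms(1) not_less)
    finally show ?thesis by (simp add: sum_distrib_right)
  qed
  ultimately have conv: "(\<lambda>k. (\<Sum>i<k. coeff R (k - i) * ?u i) * x ^ k) sums (\<Sum>k. ?u k * x ^ k)"
    by simp
  have "(\<lambda>k. ?u k * x ^ k) sums (\<Sum>k. ?u k * x ^ k)"
    using u by (intro summable_sums summable_norm_cancel[OF u])
  from sums_add[OF sums_diff[OF this conv] poly_sums[of E x]]
  have "(\<lambda>k. ?u k * x ^ k - (\<Sum>i<k. coeff R (k - i) * ?u i) * x ^ k + coeff E k * x ^ k)
      sums poly E x"
    by simp
  moreover have "?u k * x ^ k - (\<Sum>i<k. coeff R (k - i) * ?u i) * x ^ k + coeff E k * x ^ k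
      = digit R E k * x ^ k" for k
    by (simp add: residual_eq[of R E k] drift_def algebra_simps)
  ultimately show "(\<lambda>k. digit R E k * x ^ k) sums poly E x"
    by simp
qed

section \<open>Interpolation with small coefficients\<close>

text \<open>
  The interpolating polynomial is the Lagrange one; it depends linearly on the prescribed values, so
  small values give small coefficients.
\<close>

lemma exists_interpolating_poly:
  fixes x :: "'m::finite \<Rightarrow> real"
  assumes "inj x"
  shows "\<exists>M>0. \<forall>y. \<exists>E. (\<forall>j. poly E (x j) = y j) \<and> l1_norm E \<le> M * (\<Sum>j\<in>UNIV. \<bar>y j\<bar>)"
proof -
  define L where "L i = (\<Prod>j\<in>UNIV - {i}. smult (1 / (x i - x j)) [:- x j, 1:])" for i
  define M where "M = 1 + (\<Sum>i\<in>UNIV. l1_norm (L i))"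
  have L: "poly (L i) (x j) = (if i = j then 1 else 0)" for i j
  proof (cases "i = j")
    case True
    have "x i - x k \<noteq> 0" if "k \<noteq> i" for k
      using that assms by (auto simp: inj_eq)
    then have "poly (smult (1 / (x i - x k)) [:- x k, 1:]) (x i) = 1" if "k \<noteq> i" for k
      using that by (simp flip: diff_divide_distrib)
    then have "poly (L i) (x i) = 1"
      unfolding L_def poly_prod by (intro prod.neutral) auto
    then show ?thesis using True by simp
  next
    case False
    then show ?thesis by (auto simp: L_def poly_prod intro!: prod_zero bexI[of _ j])
  qed
  have "M > 0"
    using sum_nonneg[of UNIV "\<lambda>i. l1_norm (L i)"] by (simp add: M_def l1_norm_nonneg)
  moreover have "\<exists>E. (\<forall>j. poly E (x j) = y j) \<and> l1_norm E \<le> M * (\<Sum>j\<in>UNIV. \<bar>y j\<bar>)" for y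
  proof (intro exI conjI allI)
    show "poly (\<Sum>i\<in>UNIV. smult (y i) (L i)) (x j) = y j" for j
      by (simp add: poly_sum L if_distrib cong: if_cong)
    have "l1_norm (L i) \<le> M" for i
      using member_le_sum[of i UNIV "\<lambda>i. l1_norm (L i)"] by (simp add: M_def l1_norm_nonneg)
    then have "(\<Sum>i\<in>UNIV. \<bar>y i\<bar> * l1_norm (L i)) \<le> (\<Sum>i\<in>UNIV. \<bar>y i\<bar> * M)"
      by (intro sum_mono mult_left_mono) auto
    then show "l1_norm (\<Sum>i\<in>UNIV. smult (y i) (L i)) \<le> M * (\<Sum>j\<in>UNIV. \<bar>y j\<bar>)"
      using l1_norm_sum[of "\<lambda>i. smult (y i) (L i)" UNIV]
      by (simp add: mult.commute sum_distrib_left)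
  qed
  ultimately show ?thesis by blast
qed

section \<open>A small polynomial with value 1 at all given points\<close>

definition geo_mean :: "real \<Rightarrow> nat \<Rightarrow> real poly" where
  "geo_mean b K = smult (1 / real K) (\<Sum>n=1..K. monom (b ^ n) n)"

lemma coeff_geo_mean_0: "coeff (geo_mean b K) 0 = 0"
  by (simp add: geo_mean_def coeff_sum)

lemma poly_geo_mean:
  assumes "b \<noteq> 0" and "K > 0"
  shows "poly (geo_mean b K) (1 / b) = 1"
  using assms by (simp add: geo_mean_def poly_sum poly_monom power_divide)

lemma l1_norm_geo_mean:
  assumes "1 \<le> b" and "K > 0"
  shows "l1_norm (geo_mean b K) \<le> b ^ K"
proof -
  have "l1_norm (\<Sum>n=1..K. monom (b ^ n) n) \<le> (\<Sum>n=1..K. b ^ n)"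
    using l1_norm_sum[of "\<lambda>n. monom (b ^ n) n" "{1..K}"] assms by simp
  also have "\<dots> \<le> (\<Sum>n=1..K. b ^ K)"
    using assms by (intro sum_mono power_increasing) auto
  finally show ?thesis using assms by (simp add: geo_mean_def field_simps)
qed

lemma telescope_geo_mean:
  "[:1, - b:] * geo_mean b K = smult (1 / real K) (monom b 1 - monom (b ^ Suc K) (Suc K))"
proof -
  have "[:1, - b:] * (\<Sum>n=1..K. monom (b ^ n) n) = monom b 1 - monom (b ^ Suc K) (Suc K)"
  proof (induction K)
    case 0
    then show ?case by simp
  next
    case (Suc K)
    have "[:1, - b:] * monom (b ^ Suc K) (Suc K)
        = monom (b ^ Suc K) (Suc K) - monom (b ^ Suc (Suc K)) (Suc (Suc K))"
      by (rule poly_eqI) (auto simp: coeff_pCons split: nat.split)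
    with Suc show ?case by (simp add: distrib_left del: mult_pCons_left)
  qed
  then show ?thesis by (simp add: geo_mean_def del: mult_pCons_left)
qed

text \<open>
  The factor \<open>1 - c z\<close> is a perturbation by \<open>(b - c) z\<close> of \<open>1 - b z\<close>, whose product with the mean
  telescopes. If \<open>b\<close> and \<open>c\<close> are close enough to 1 in terms of \<open>K\<close>, the bound is of order \<open>1 / K\<close>.
\<close>

lemma l1_norm_linear_mult_geo_mean:
  assumes "1 \<le> b" and "K > 0"
  shows "l1_norm ([:1, - c:] * geo_mean b K) \<le> 2 * b ^ Suc K / real K + \<bar>b - c\<bar> * b ^ K"
proof -
  have "[:1, - c:] = [:1, - b:] + [:0, b - c:]"
    by simp
  then have "l1_norm ([:1, - c:] * geo_mean b K)
      \<le> l1_norm ([:1, - b:] * geo_mean b K) + l1_norm ([:0, b - c:] * geo_mean b K)"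
    by (metis distrib_right l1_norm_add)
  moreover have "l1_norm ([:1, - b:] * geo_mean b K) \<le> 2 * b ^ Suc K / real K"
  proof -
    have "b ^ 1 \<le> b ^ Suc K"
      using assms by (intro power_increasing) auto
    then have "l1_norm (monom b 1 - monom (b ^ Suc K) (Suc K)) \<le> 2 * b ^ Suc K"
      using l1_norm_diff[of "monom b 1" "monom (b ^ Suc K) (Suc K)"] assms
      by (simp del: power_Suc)
    then show ?thesis
      unfolding telescope_geo_mean using assms by (simp add: divide_right_mono)
  qed
  moreover have "l1_norm ([:0, b - c:] * geo_mean b K) \<le> \<bar>b - c\<bar> * b ^ K"
  proof -
    have "l1_norm ([:0, b - c:] * geo_mean b K) \<le> \<bar>b - c\<bar> * l1_norm (geo_mean b K)"
      using l1_norm_mult[of "[:0, b - c:]" "geo_mean b K"] by simp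
    also have "\<dots> \<le> \<bar>b - c\<bar> * b ^ K"
      using l1_norm_geo_mean[OF assms] by (intro mult_left_mono) auto
    finally show ?thesis .
  qed
  ultimately show ?thesis by linarith
qed

text \<open>
  Multiplying the product by another factor \<open>1 - r k\<close> subtracts \<open>q * r k * (\<Prod>j\<in>S. 1 - r j)\<close>, which
  contains the tiny factor \<open>q * r k\<close>; the other factors have norm at most 3 each.
\<close>

lemma l1_norm_one_minus_prod:
  assumes "finite S"
    and r: "\<And>j. j \<in> S \<Longrightarrow> l1_norm (r j) \<le> 2"
    and qr: "\<And>j. j \<in> S \<Longrightarrow> l1_norm (q * r j) \<le> \<epsilon>"
    and "0 \<le> \<epsilon>"
  shows "l1_norm (1 - q * (\<Prod>j\<in>S. 1 - r j)) \<le> l1_norm (1 - q) + \<epsilon> * 3 ^ card S"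
  using assms(1-3)
proof (induction S rule: finite_induct)
  case empty
  then show ?case using \<open>0 \<le> \<epsilon>\<close> by simp
next
  case (insert k S)
  let ?P = "\<Prod>j\<in>S. 1 - r j"
  have "1 - q * (\<Prod>j\<in>insert k S. 1 - r j) = (1 - q * ?P) + (q * r k) * ?P"
    using insert.hyps by (simp add: algebra_simps)
  then have "l1_norm (1 - q * (\<Prod>j\<in>insert k S. 1 - r j))
      \<le> l1_norm (1 - q * ?P) + l1_norm ((q * r k) * ?P)"
    by (metis l1_norm_add)
  moreover have "l1_norm ((q * r k) * ?P) \<le> \<epsilon> * 3 ^ card S"
  proof -
    have "l1_norm (1 - r j) \<le> 3" if "j \<in> S" for j
      using insert.prems(1)[of j] that l1_norm_diff[of 1 "r j"] by (simp add: one_pCons)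
    then have "l1_norm ?P \<le> 3 ^ card S"
      by (rule l1_norm_prod_le)
    then have "l1_norm (q * r k) * l1_norm ?P \<le> \<epsilon> * 3 ^ card S"
      using insert.prems(2)[of k] \<open>0 \<le> \<epsilon>\<close> by (intro mult_mono) (auto simp: l1_norm_nonneg)
    then show ?thesis using l1_norm_mult[of "q * r k" ?P] by linarith
  qed
  moreover have "l1_norm (1 - q * ?P) \<le> l1_norm (1 - q) + \<epsilon> * 3 ^ card S"
    using insert by auto
  moreover have "0 \<le> \<epsilon> * 3 ^ card S"
    using \<open>0 \<le> \<epsilon>\<close> by simp
  ultimately show ?case using insert.hyps by simp
qed

text \<open>
  The order of the choices matters: the tolerance \<open>\<epsilon>\<close> is dictated by the number of factors, then
  the length \<open>K\<close> of the averages by \<open>\<epsilon>\<close>, and finally \<open>C\<close> is taken so close to 1 that powers of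
  the parameters up to \<open>K + 1\<close> are at most 2 and the parameters differ by at most \<open>\<epsilon> / 4\<close>.
\<close>

lemma exists_small_poly_one_at_inverses:
  "\<exists>C::real>1. \<forall>\<beta> :: 'm::finite \<Rightarrow> real. (\<forall>j. 1 < \<beta> j \<and> \<beta> j < C) \<longrightarrow>
    (\<exists>R. coeff R 0 = 0 \<and> l1_norm R \<le> 3/2 \<and> (\<forall>j. poly R (1 / \<beta> j) = 1))"
proof -
  define \<epsilon> :: real where "\<epsilon> = 1 / (4 * 3 ^ CARD('m))"
  have \<epsilon>: "0 < \<epsilon>" "\<epsilon> * 3 ^ CARD('m) = 1/4"
    by (simp_all add: \<epsilon>_def)
  obtain K :: nat where K: "8 / \<epsilon> < real K"
    using reals_Archimedean2 by blast
  have K0: "K > 0" "4 / real K \<le> \<epsilon> / 2"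
  proof -
    have "0 < 8 / \<epsilon>" using \<epsilon> by simp
    then show K0: "K > 0" using K by linarith
    show "4 / real K \<le> \<epsilon> / 2" using K K0 \<epsilon>(1) by (simp add: field_simps)
  qed
  define C where "C = min (min (5/4) (1 + \<epsilon> / 4)) (root (Suc K) 2)"
  have "1 < C"
    using \<epsilon> by (simp add: C_def)
  moreover have "\<exists>R. coeff R 0 = 0 \<and> l1_norm R \<le> 3/2 \<and> (\<forall>j. poly R (1 / \<beta> j) = 1)"
    if \<beta>: "\<And>j. 1 < \<beta> j \<and> \<beta> j < C" for \<beta> :: "'m \<Rightarrow> real"
  proof -
    fix i :: 'm
    define q where "q = [:1, - \<beta> i:]"
    define r where "r j = geo_mean (\<beta> j) K" for j
    define R where "R = 1 - q * (\<Prod>j\<in>UNIV - {i}. 1 - r j)"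
    have pow: "\<beta> j ^ Suc K \<le> 2" "\<beta> j ^ K \<le> 2" for j
    proof -
      have "\<beta> j ^ Suc K \<le> root (Suc K) 2 ^ Suc K"
        using \<beta>[of j] by (intro power_mono) (auto simp: C_def)
      then show "\<beta> j ^ Suc K \<le> 2"
        by (simp del: power_Suc)
      moreover have "\<beta> j ^ K \<le> \<beta> j ^ Suc K"
        using \<beta>[of j] by (intro power_increasing) auto
      ultimately show "\<beta> j ^ K \<le> 2" by linarith
    qed
    have r: "l1_norm (r j) \<le> 2" for j
      using l1_norm_geo_mean[of "\<beta> j" K] K0 \<beta>[of j] pow(2)[of j] by (simp add: r_def)
    have qr: "l1_norm (q * r j) \<le> \<epsilon>" for j
    proof -
      have "\<bar>\<beta> j - \<beta> i\<bar> \<le> \<epsilon> / 4"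
        using \<beta>[of j] \<beta>[of i] unfolding C_def by linarith
      then have "\<bar>\<beta> j - \<beta> i\<bar> * \<beta> j ^ K \<le> \<epsilon> / 4 * 2"
        using \<beta>[of j] pow(2)[of j] \<epsilon> by (intro mult_mono) auto
      moreover have "2 * \<beta> j ^ Suc K / real K \<le> 4 / real K"
        using pow(1)[of j] by (intro divide_right_mono) auto
      moreover have "l1_norm (q * r j) \<le> 2 * \<beta> j ^ Suc K / real K + \<bar>\<beta> j - \<beta> i\<bar> * \<beta> j ^ K"
        unfolding q_def r_def
        using \<beta>[of j] K0 by (intro l1_norm_linear_mult_geo_mean) auto
      ultimately show ?thesis using K0 by linarith
    qed
    have "l1_norm R \<le> l1_norm (1 - q) + \<epsilon> * 3 ^ card (UNIV - {i})"
      unfolding R_def using r qr \<epsilon> by (intro l1_norm_one_minus_prod) auto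
    also have "\<dots> \<le> l1_norm (1 - q) + \<epsilon> * 3 ^ CARD('m)"
      using \<epsilon> by (intro add_left_mono mult_left_mono power_increasing card_mono) auto
    also have "\<dots> \<le> 3/2"
      using \<beta>[of i] \<epsilon>(2) by (simp add: q_def C_def one_pCons)
    finally have "l1_norm R \<le> 3/2" .
    moreover have "coeff R 0 = 0"
      unfolding R_def q_def r_def
      by (simp add: poly_prod poly_0_coeff_0[symmetric] coeff_geo_mean_0[unfolded poly_0_coeff_0[symmetric]])
    moreover have "poly R (1 / \<beta> j) = 1" for j
    proof (cases "j = i")
      case True
      then show ?thesis using \<beta>[of i] by (simp add: R_def q_def)
    next
      case False
      have "poly (1 - r j) (1 / \<beta> j) = 0"
        using \<beta>[of j] K0 by (simp add: r_def poly_geo_mean)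
      then have "(\<Prod>k\<in>UNIV - {i}. poly (1 - r k) (1 / \<beta> j)) = 0"
        using False by (intro prod_zero) auto
      then show ?thesis by (simp add: R_def poly_prod)
    qed
    ultimately show ?thesis by blast
  qed
  ultimately show ?thesis by blast
qed

section \<open>The attractor as the set of all sign expansions\<close>

definition address :: "('m::finite \<Rightarrow> real) \<Rightarrow> (nat \<Rightarrow> real) \<Rightarrow> real ^ 'm" where
  "address \<beta> a = (\<chi> j. \<Sum>n. a n / \<beta> j ^ Suc n)"

abbreviation sign_seqs :: "(nat \<Rightarrow> real) set" where
  "sign_seqs \<equiv> {a. \<forall>n. a n \<in> {-1, 1}}"

text \<open>
  This is the composition \<open>ifs_map \<beta> (a 0) \<circ> \<dots> \<circ> ifs_map \<beta> (a (N - 1))\<close> in closed form.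
\<close>

definition word_map :: "('m::finite \<Rightarrow> real) \<Rightarrow> (nat \<Rightarrow> real) \<Rightarrow> nat \<Rightarrow> real ^ 'm \<Rightarrow> real ^ 'm" where
  "word_map \<beta> a N p = (\<chi> j. (\<Sum>n<N. a n / \<beta> j ^ Suc n) + p $ j / \<beta> j ^ N)"

lemma word_map_0: "word_map \<beta> a 0 p = p"
  by (simp add: word_map_def vec_eq_iff)

lemma word_map_Suc: "word_map \<beta> a (Suc N) p = word_map \<beta> a N (ifs_map \<beta> (a N) p)"
  by (simp add: word_map_def ifs_map_def vec_eq_iff add_divide_distrib mult.commute)

context
  fixes \<beta> :: "'m::finite \<Rightarrow> real"
  assumes \<beta>: "\<And>j. 1 < \<beta> j"
begin

lemma summable_inverse_powers: "summable (\<lambda>n. 1 / \<beta> j ^ Suc n)"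
proof -
  have "summable (\<lambda>n. (1 / \<beta> j) * (1 / \<beta> j) ^ n)"
    using \<beta>[of j] by (intro summable_mult summable_geometric) auto
  then show ?thesis by (simp add: power_divide)
qed

lemma norm_digit_term:
  assumes "a \<in> sign_seqs"
  shows "norm (a n / \<beta> j ^ Suc n) \<le> 1 / \<beta> j ^ Suc n"
proof -
  have "a n \<in> {-1, 1}" using assms by auto
  then show ?thesis using \<beta>[of j] by auto
qed

lemma summable_digits:
  assumes "a \<in> sign_seqs"
  shows "summable (\<lambda>n. a n / \<beta> j ^ Suc n)"
  using summable_inverse_powers norm_digit_term[OF assms] by (rule summable_comparison_test')

lemma word_map_tendsto_address:
  assumes "a \<in> sign_seqs" and "bounded (range p)"
  shows "(\<lambda>N. word_map \<beta> a N (p N)) \<longlonglongrightarrow> address \<beta> a"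
proof (rule vec_tendstoI)
  fix j
  obtain B where B: "\<And>N. norm (p N) \<le> B"
    using assms(2) by (auto simp: bounded_iff)
  have "(\<lambda>N. p N $ j / \<beta> j ^ N) \<longlonglongrightarrow> 0"
  proof (rule Lim_null_comparison)
    show "\<forall>\<^sub>F N in sequentially. norm (p N $ j / \<beta> j ^ N) \<le> B * (1 / \<beta> j) ^ N"
    proof (rule always_eventually, rule allI)
      fix N
      have "\<bar>p N $ j\<bar> \<le> B"
        using B[of N] component_le_norm_cart[of "p N" j] by linarith
      then show "norm (p N $ j / \<beta> j ^ N) \<le> B * (1 / \<beta> j) ^ N"
        using \<beta>[of j] by (simp add: power_divide divide_right_mono)
    qed
    show "(\<lambda>N. B * (1 / \<beta> j) ^ N) \<longlonglongrightarrow> 0"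
      using \<beta>[of j] by (intro tendsto_mult_right_zero LIMSEQ_power_zero) auto
  qed
  from tendsto_add[OF summable_LIMSEQ[OF summable_digits[OF assms(1), of j]] this]
  show "(\<lambda>N. word_map \<beta> a N (p N) $ j) \<longlonglongrightarrow> address \<beta> a $ j"
    by (simp add: word_map_def address_def)
qed

lemma address_shift:
  assumes "a \<in> sign_seqs"
  shows "address \<beta> a = ifs_map \<beta> (a 0) (address \<beta> (\<lambda>n. a (Suc n)))"
proof -
  have "(\<Sum>n. a n / \<beta> j ^ Suc n) = ((\<Sum>n. a (Suc n) / \<beta> j ^ Suc n) + a 0) / \<beta> j" for j
  proof -
    have s: "summable (\<lambda>n. a (Suc n) / \<beta> j ^ Suc n)"
      by (rule summable_digits) (use assms in auto)
    have "(\<Sum>n. a n / \<beta> j ^ Suc n) = a 0 / \<beta> j + (\<Sum>n. a (Suc n) / \<beta> j ^ Suc (Suc n))"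
      using suminf_split_head[OF summable_digits[OF assms, of j]] by simp
    also have "(\<Sum>n. a (Suc n) / \<beta> j ^ Suc (Suc n)) = (\<Sum>n. a (Suc n) / \<beta> j ^ Suc n) / \<beta> j"
      using suminf_divide[OF s, of "\<beta> j"] by (simp add: mult.commute)
    finally show ?thesis by (simp add: add_divide_distrib)
  qed
  then show ?thesis by (simp add: address_def ifs_map_def vec_eq_iff)
qed

lemma address_image_invariant:
  "address \<beta> ` sign_seqs = ifs_map \<beta> 1 ` address \<beta> ` sign_seqs \<union> ifs_map \<beta> (-1) ` address \<beta> ` sign_seqs"
  (is "?A = ?B")
proof
  show "?A \<subseteq> ?B"
  proof
    fix x assume "x \<in> ?A"
    then obtain a where a: "a \<in> sign_seqs" "x = address \<beta> a" by auto
    then have "a 0 \<in> {-1, 1}" "(\<lambda>n. a (Suc n)) \<in> sign_seqs" by auto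
    then show "x \<in> ?B" using address_shift[OF a(1)] a(2) by auto
  qed
  show "?B \<subseteq> ?A"
  proof
    fix x assume "x \<in> ?B"
    then obtain a and i :: real where a: "a \<in> sign_seqs" "i \<in> {-1, 1}" "x = ifs_map \<beta> i (address \<beta> a)"
      by auto
    then have "case_nat i a \<in> sign_seqs" by (auto split: nat.split)
    moreover from this have "x = address \<beta> (case_nat i a)"
      using address_shift[of "case_nat i a"] a(3) by simp
    ultimately show "x \<in> ?A" by blast
  qed
qed

text \<open>
  The sign sequences form a compact product space, and the address is a uniform limit of functions
  that depend on finitely many signs each.
\<close>

lemma compact_address_image: "compact (address \<beta> ` sign_seqs)"
proof (rule compact_continuous_image)
  show "compact sign_seqs"
  proof -
    have "sign_seqs = (\<Pi>\<^sub>E n\<in>UNIV. {-1, 1})"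
      by (auto simp: PiE_def Pi_def)
    moreover have "compactin (product_topology (\<lambda>n::nat. euclidean) UNIV) (\<Pi>\<^sub>E n\<in>UNIV. {-1, 1::real})"
      by (simp add: compactin_PiE)
    ultimately show ?thesis
      by (simp add: euclidean_product_topology)
  qed
  have "continuous_on sign_seqs (\<lambda>a. \<Sum>n. a n / \<beta> j ^ Suc n)" for j
  proof (rule uniform_limit_theorem)
    show "uniform_limit sign_seqs (\<lambda>N a. \<Sum>n<N. a n / \<beta> j ^ Suc n)
        (\<lambda>a. \<Sum>n. a n / \<beta> j ^ Suc n) sequentially"
      by (rule Weierstrass_m_test[OF _ summable_inverse_powers]) (rule norm_digit_term)
    show "\<forall>\<^sub>F N in sequentially. continuous_on sign_seqs (\<lambda>a. \<Sum>n<N. a n / \<beta> j ^ Suc n)"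
    proof (rule always_eventually, rule allI)
      fix N
      have "\<beta> j ^ Suc n \<noteq> 0" for n
        using \<beta>[of j] by simp
      moreover have "continuous_on sign_seqs (\<lambda>a. a n)" for n
        by (rule continuous_on_subset[OF continuous_on_product_coordinates subset_UNIV])
      ultimately show "continuous_on sign_seqs (\<lambda>a. \<Sum>n<N. a n / \<beta> j ^ Suc n)"
        by (intro continuous_on_sum continuous_on_divide continuous_on_const) auto
    qed
  qed simp
  then show "continuous_on sign_seqs (address \<beta>)"
    unfolding address_def by (intro continuous_on_vec_lambda)
qed

text \<open>
  An invariant set contains all finite compositions of the two maps applied to one of its points, and
  these converge to any prescribed address. Conversely, each point of the set has an infinite chain
  of preimages within the set, and the signs met along the chain form its address because the chain
  is bounded.
\<close>

lemma invariant_set_eq_address_image: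
  assumes "A \<noteq> {}" "compact A" and inv: "A = ifs_map \<beta> 1 ` A \<union> ifs_map \<beta> (-1) ` A"
  shows "A = address \<beta> ` sign_seqs"
proof
  have bdd: "bounded (range p)" if "\<And>n. p n \<in> A" for p :: "nat \<Rightarrow> _"
    using compact_imp_bounded[OF \<open>compact A\<close>] by (rule bounded_subset) (use that in auto)
  show "address \<beta> ` sign_seqs \<subseteq> A"
  proof (rule image_subsetI)
    fix a assume a: "a \<in> sign_seqs"
    obtain p where p: "p \<in> A" using \<open>A \<noteq> {}\<close> by auto
    have "ifs_map \<beta> (a N) x \<in> A" if "x \<in> A" for x N
    proof -
      have "a N = 1 \<or> a N = -1" using a by auto
      then have "ifs_map \<beta> (a N) x \<in> ifs_map \<beta> 1 ` A \<union> ifs_map \<beta> (-1) ` A"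
        using that by auto
      then show ?thesis by (rule subsetD[OF equalityD2[OF inv]])
    qed
    then have "word_map \<beta> a N x \<in> A" if "x \<in> A" for x N
      using that by (induction N arbitrary: x) (auto simp: word_map_0 word_map_Suc)
    with p show "address \<beta> a \<in> A"
      using closed_sequentially[OF compact_imp_closed[OF \<open>compact A\<close>] _ 
          word_map_tendsto_address[OF a bdd[of "\<lambda>_. p"]]]
      by blast
  qed
  show "A \<subseteq> address \<beta> ` sign_seqs"
  proof
    fix x assume "x \<in> A"
    have "\<exists>f. f 0 = x \<and> (\<forall>n. f n \<in> A \<and> (\<exists>i\<in>{-1, 1}. f n = ifs_map \<beta> i (f (Suc n))))"
    proof -
      have "\<exists>z. z \<in> A \<and> (\<exists>i\<in>{-1, 1}. y = ifs_map \<beta> i z)" if "y \<in> A" for y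
        using subsetD[OF equalityD1[OF inv] that] by auto
      then obtain g where g: "\<And>y. y \<in> A \<Longrightarrow> g y \<in> A \<and> (\<exists>i\<in>{-1, 1}. y = ifs_map \<beta> i (g y))"
        by metis
      have "(g ^^ n) x \<in> A" for n
        by (induction n) (use \<open>x \<in> A\<close> g in auto)
      then show ?thesis
        using g by (intro exI[of _ "\<lambda>n. (g ^^ n) x"]) auto
    qed
    then obtain f a where f: "f 0 = x" "\<And>n. f n \<in> A"
      and a: "\<And>n. a n \<in> {-1, 1}" and step: "\<And>n. f n = ifs_map \<beta> (a n) (f (Suc n))"
      by metis
    have "a \<in> sign_seqs" using a by auto
    have "word_map \<beta> a N (f N) = x" for N
      by (induction N) (simp_all add: word_map_0 word_map_Suc f(1) flip: step)
    then have "(\<lambda>N. x) \<longlonglongrightarrow> address \<beta> a"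
      using word_map_tendsto_address[OF \<open>a \<in> sign_seqs\<close> bdd[of f]] f(2) by simp
    then have "x = address \<beta> a"
      by (simp add: LIMSEQ_const_iff)
    with \<open>a \<in> sign_seqs\<close> show "x \<in> address \<beta> ` sign_seqs" by auto
  qed
qed

lemma attractor_eq_address_image: "attractor \<beta> = address \<beta> ` sign_seqs"
  unfolding attractor_def
proof (rule the_equality, intro conjI)
  show "address \<beta> ` sign_seqs \<noteq> {}"
    by (auto simp: PiE_eq_empty_iff)
  show "address \<beta> ` sign_seqs = ifs_map \<beta> 1 ` address \<beta> ` sign_seqs \<union>
      ifs_map \<beta> (-1) ` address \<beta> ` sign_seqs"
    by (rule address_image_invariant)
qed (use compact_address_image invariant_set_eq_address_image in auto)

end

section \<open>A neighbourhood of the origin\<close>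

text \<open>
  The slack \<open>2 - l1_norm R\<close> is spent on a polynomial \<open>E\<close> that takes the value \<open>\<beta> j * v $ j\<close> at
  \<open>1 / \<beta> j\<close>; the factor \<open>\<beta> j\<close> compensates for the expansion starting with \<open>1 / \<beta> j\<close> instead of 1.
\<close>

lemma neighbourhood_in_attractor:
  fixes \<beta> :: "'m::finite \<Rightarrow> real"
  assumes \<beta>: "\<And>j. 1 < \<beta> j" and "inj \<beta>"
    and R: "coeff R 0 = 0" "l1_norm R < 2" "\<And>j. poly R (1 / \<beta> j) = 1"
  shows "\<exists>U. open U \<and> 0 \<in> U \<and> U \<subseteq> attractor \<beta>"
proof -
  have "inj (\<lambda>j. 1 / \<beta> j)"
    using \<open>inj \<beta>\<close> by (auto simp: inj_def)
  then obtain M where "M > 0" and M: "\<And>y. \<exists>E. (\<forall>j. poly E (1 / \<beta> j) = y j) \<and>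
      l1_norm E \<le> M * (\<Sum>j\<in>UNIV. \<bar>y j\<bar>)"
    using exists_interpolating_poly by blast
  define s where "s = (\<Sum>j\<in>UNIV. \<beta> j)"
  have "s > 0"
    unfolding s_def by (rule sum_pos) (use \<beta> less_trans[OF zero_less_one] in auto)
  define \<delta> where "\<delta> = (2 - l1_norm R) / (M * s)"
  have "\<delta> > 0"
    using R(2) \<open>M > 0\<close> \<open>s > 0\<close> by (simp add: \<delta>_def)
  have "v \<in> attractor \<beta>" if v: "norm v < \<delta>" for v :: "real ^ 'm"
  proof -
    obtain E where E: "\<And>j. poly E (1 / \<beta> j) = v $ j * \<beta> j"
      "l1_norm E \<le> M * (\<Sum>j\<in>UNIV. \<bar>v $ j * \<beta> j\<bar>)"
      using M[of "\<lambda>j. v $ j * \<beta> j"] by auto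
    have "(\<Sum>j\<in>UNIV. \<bar>v $ j * \<beta> j\<bar>) \<le> (\<Sum>j\<in>UNIV. \<delta> * \<beta> j)"
    proof (rule sum_mono)
      fix j
      have "\<bar>v $ j\<bar> \<le> \<delta>" "0 \<le> \<beta> j"
        using component_le_norm_cart[of v j] v \<beta>[of j] by linarith+
      then show "\<bar>v $ j * \<beta> j\<bar> \<le> \<delta> * \<beta> j"
        by (simp add: abs_mult mult_right_mono)
    qed
    then have "M * (\<Sum>j\<in>UNIV. \<bar>v $ j * \<beta> j\<bar>) \<le> M * (\<delta> * s)"
      using \<open>M > 0\<close> by (simp add: s_def flip: sum_distrib_left)
    also have "\<dots> = 2 - l1_norm R"
      using \<open>M > 0\<close> \<open>s > 0\<close> by (simp add: \<delta>_def)
    finally have "l1_norm R + l1_norm E \<le> 2"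
      using E(2) by linarith
    from exists_sign_expansion[OF R(1) this] obtain a where a: "\<And>n. a n \<in> {-1, 1}"
      and sums: "\<And>x. \<bar>x\<bar> < 1 \<Longrightarrow> poly R x = 1 \<Longrightarrow> (\<lambda>n. a n * x ^ n) sums poly E x"
      by blast
    have "(\<Sum>n. a n / \<beta> j ^ Suc n) = v $ j" for j
    proof -
      have "(\<lambda>n. a n * (1 / \<beta> j) ^ n / \<beta> j) sums (v $ j * \<beta> j / \<beta> j)"
        using sums[of "1 / \<beta> j"] R(3)[of j] \<beta>[of j] unfolding E(1) by (intro sums_divide) auto
      then show ?thesis
        using \<beta>[of j] by (simp add: sums_iff power_divide mult.commute)
    qed
    then have "v = address \<beta> a"
      by (simp add: address_def vec_eq_iff)
    then show ?thesis
      using a by (auto simp: attractor_eq_address_image[OF \<beta>])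
  qed
  then show ?thesis
    using \<open>\<delta> > 0\<close> by (intro exI[of _ "ball 0 \<delta>"]) (auto simp: dist_norm)
qed

theorem theorem1p4:
  assumes "CARD('m::{finite,linorder}) \<ge> 2"
  shows "\<exists>C::real. C > 1 \<and>
    (\<forall>\<beta> :: 'm \<Rightarrow> real.
       (\<forall>j. 1 < \<beta> j \<and> \<beta> j < C) \<and> strict_mono \<beta> \<longrightarrow>
       (\<exists>U. open U \<and> 0 \<in> U \<and> U \<subseteq> attractor \<beta>))"
proof -
  obtain C :: real where "1 < C"
    and C: "\<And>\<beta> :: 'm \<Rightarrow> real. (\<And>j. 1 < \<beta> j \<and> \<beta> j < C) \<Longrightarrow>
      \<exists>R. coeff R 0 = 0 \<and> l1_norm R \<le> 3/2 \<and> (\<forall>j. poly R (1 / \<beta> j) = 1)"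
    using exists_small_poly_one_at_inverses[where 'm = 'm] by blast
  have "\<exists>U. open U \<and> 0 \<in> U \<and> U \<subseteq> attractor \<beta>"
    if \<beta>: "\<And>j. 1 < \<beta> j \<and> \<beta> j < C" and "strict_mono \<beta>" for \<beta> :: "'m \<Rightarrow> real"
  proof -
    obtain R where "coeff R 0 = 0" "l1_norm R \<le> 3/2" "\<And>j. poly R (1 / \<beta> j) = 1"
      using C[of \<beta>] \<beta> by blast
    then show ?thesis
      using \<beta> strict_mono_imp_inj_on[OF \<open>strict_mono \<beta>\<close>]
      by (intro neighbourhood_in_attractor[of \<beta> R]) auto
  qed
  with \<open>1 < C\<close> show ?thesis by blast
qed

end
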